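(* If $G\subsetneq\mathbb{R}^n$ is a domain and the inequality $s_G(x,y)\geq p_G(x,y)$ holds for all $x,y\in G$, then the complement $\mathbb{R}^n\setminus G$ is a connected, convex set.
   Context: A domain is a non-empty open connected set. For a domain $G\subsetneq\mathbb{R}^n$ and $x\in G$, $d_G(x)=\inf\{|x-z| : z\in\partial G\}$. The triangular ratio metric is $$s_G(x,y)=\frac{|x-y|}{\inf_{z\in\partial G}(|x-z|+|z-y|)},\quad x,y\in G,$$ and the point pair function is $$p_G(x,y)=\frac{|x-y|}{\sqrt{|x-y|^2+4d_G(x)d_G(y)}},\quad x,y\in G.$$ *)

theory Defs
  imports "HOL-Analysis.Analysis"
begin

definition is_domain :: "'a::topological_space set \<Rightarrow> bool" where
  "is_domain G \<longleftrightarrow> G \<noteq> {} \<and> open G \<and> connected G"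

(* For a domain G other than the whole space, frontier G is nonempty, so infdist and INF below
   are genuine infima, bounded below by 0. *)

definition boundary_dist :: "'a::real_normed_vector set \<Rightarrow> 'a \<Rightarrow> real" where
  "boundary_dist G x = infdist x (frontier G)"

definition triangular_ratio :: "'a::real_normed_vector set \<Rightarrow> 'a \<Rightarrow> 'a \<Rightarrow> real" where
  "triangular_ratio G x y =
     norm (x - y) / (INF z\<in>frontier G. norm (x - z) + norm (z - y))"

definition point_pair :: "'a::real_normed_vector set \<Rightarrow> 'a \<Rightarrow> 'a \<Rightarrow> real" where
  "point_pair G x y =
     norm (x - y) / sqrt ((norm (x - y))\<^sup>2 + 4 * boundary_dist G x * boundary_dist G y)"

end

theory Submission
  imports Defs
begin

text \<open>
  By Motzkin's theorem, a closed set \<open>C\<close> that is not convex has a point \<open>x\<close> with two distinct nearest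
  points \<open>x + a\<close> and \<open>x + b\<close> in \<open>C\<close>. For \<open>C\<close> the complement of \<open>G\<close>, moving from \<open>x\<close> a quarter of the
  way towards each of them gives two points of \<open>G\<close> that violate the inequality, because
  \<open>norm (a + b) < 2 d\<close>, where \<open>d\<close> is the distance of \<open>x\<close> from \<open>C\<close>.

  To find \<open>x\<close>, take \<open>m\<close> outside \<open>C\<close> on a segment with endpoints in \<open>C\<close> and maximise
  \<open>dist(x, C) - sqrt ((norm (x - m))\<^sup>2 + K\<^sup>2)\<close> with \<open>K = dist(m, C) / 2\<close>. The segment makes the
  maximum attained. If the nearest point at a maximiser were unique, the distance function would have
  a gradient of norm \<open>1\<close> there, whereas the subtracted term has a gradient of norm less than \<open>1\<close>.
\<close>

text \<open>The vectors \<open>p - m\<close> and \<open>q - m\<close> are nonnegative multiples of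
  \<open>p - q\<close> and \<open>q - p\<close>, and one of these has nonnegative inner product with
  \<open>x - m\<close>. For that endpoint the cross term in the expanded square only helps.\<close>

lemma min_dist_le_segment:
  fixes p q m x :: "'a::euclidean_space"
  assumes "m \<in> closed_segment p q"
  shows "\<exists>z\<in>{p, q}. (dist x z)\<^sup>2 \<le> (dist x m)\<^sup>2 + (dist p q)\<^sup>2"
proof -
  obtain s where s: "0 \<le> s" "s \<le> 1" "m = (1 - s) *\<^sub>R p + s *\<^sub>R q"
    using assms by (auto simp: closed_segment_def)
  have pm: "p - m = s *\<^sub>R (p - q)" and qm: "q - m = (1 - s) *\<^sub>R (q - p)"
    using s by (auto simp: algebra_simps)
  have *: "(dist x z)\<^sup>2 \<le> (dist x m)\<^sup>2 + (dist p q)\<^sup>2"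
    if z: "z - m = r *\<^sub>R w" "0 \<le> r" "r \<le> 1" "norm w = dist p q" "0 \<le> (x - m) \<bullet> w" for z r w
  proof -
    have "norm (r *\<^sub>R w) \<le> dist p q"
      using z mult_right_mono[of r 1 "norm w"] by simp
    then have "(norm (r *\<^sub>R w))\<^sup>2 \<le> (dist p q)\<^sup>2"
      by (intro power_mono) auto
    moreover have "0 \<le> r * ((x - m) \<bullet> w)"
      using z by simp
    moreover have "(dist x z)\<^sup>2 = (dist x m)\<^sup>2 - 2 * (r * ((x - m) \<bullet> w)) + (norm (r *\<^sub>R w))\<^sup>2"
    proof -
      have eq: "x - z = (x - m) - r *\<^sub>R w"
        using z(1) by (metis diff_diff_eq2 diff_add_cancel)
      show ?thesis
        unfolding dist_norm eq power2_norm_eq_inner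
        by (simp add: inner_diff_left inner_diff_right inner_commute algebra_simps)
    qed
    ultimately show ?thesis by linarith
  qed
  show ?thesis
  proof (cases "0 \<le> (x - m) \<bullet> (p - q)")
    case True
    then show ?thesis using *[OF pm] s by (auto simp: dist_norm)
  next
    case False
    then have "0 \<le> (x - m) \<bullet> (q - p)" by (simp add: inner_diff_right)
    then show ?thesis using *[OF qm] s by (auto simp: dist_norm norm_minus_commute)
  qed
qed

text \<open>Outside a large ball around \<open>m\<close> the objective does not exceed its value at
  \<open>m\<close>, so a maximum over the compact ball is global.\<close>

lemma penalised_infdist_attains_max:
  fixes C :: "'a::euclidean_space set"
  assumes "p \<in> C" "q \<in> C" "m \<in> closed_segment p q" and K: "0 < K" "K < infdist m C"
  shows "\<exists>x0. \<forall>x. infdist x C - sqrt ((dist x m)\<^sup>2 + K\<^sup>2)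
                  \<le> infdist x0 C - sqrt ((dist x0 m)\<^sup>2 + K\<^sup>2)"
proof -
  define g where "g = (\<lambda>x. infdist x C - sqrt ((dist x m)\<^sup>2 + K\<^sup>2))"
  define D where "D = infdist m C - K"
  \<comment> \<open>Chosen so that \<open>dist x m > M\<close> makes the squared bound of the
    segment lemma at most the square of \<open>dist x m + D\<close>.\<close>
  define M where "M = (dist p q)\<^sup>2 / (2 * D)"
  have D: "D > 0" and M: "M \<ge> 0"
    using K by (auto simp: D_def M_def)
  have gm: "g m = D"
    using K by (simp add: g_def D_def)
  have "continuous_on (cball m M) g"
    unfolding g_def by (intro continuous_intros)
  moreover have "cball m M \<noteq> {}"
    using M by simp
  ultimately obtain x0 where x0: "\<And>x. x \<in> cball m M \<Longrightarrow> g x \<le> g x0"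
    using continuous_attains_sup[OF compact_cball] by blast
  have "g x \<le> g x0" for x
  proof (cases "x \<in> cball m M")
    case False
    then have R: "M < dist x m" by (simp add: dist_commute)
    obtain z where z: "z \<in> C" "(dist x z)\<^sup>2 \<le> (dist x m)\<^sup>2 + (dist p q)\<^sup>2"
      using min_dist_le_segment[OF assms(3), of x] assms by auto
    have "(dist p q)\<^sup>2 = 2 * M * D"
      using D by (simp add: M_def)
    also have "\<dots> \<le> 2 * dist x m * D"
      using R D by simp
    finally have "(dist x z)\<^sup>2 \<le> (dist x m + D)\<^sup>2"
      using z(2) zero_le_power2[of D] unfolding power2_sum by linarith
    then have "dist x z \<le> dist x m + D"
      by (rule power2_le_imp_le) (use D in simp)
    moreover have "infdist x C \<le> dist x z"
      using z(1) by (rule infdist_le)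
    moreover have "dist x m \<le> sqrt ((dist x m)\<^sup>2 + K\<^sup>2)"
      by (intro real_le_rsqrt) simp
    ultimately have "g x \<le> D" unfolding g_def by linarith
    also have "D \<le> g x0" using x0[of m] gm M by simp
    finally show ?thesis .
  qed (use x0 in simp)
  then show ?thesis unfolding g_def by blast
qed

text \<open>The gradient argument is run with finite steps: move the maximiser \<open>x\<close> by
  \<open>t\<close> straight away from a nearest point \<open>u\<close>. The distance to
  \<open>C\<close> grows too slowly for the nearest points of the moved point to stay close to
  \<open>u\<close>, and letting \<open>t\<close> tend to 0 yields a second nearest point of
  \<open>x\<close>.\<close>

theorem closed_not_convex_two_nearest_points:
  fixes C :: "'a::euclidean_space set"
  assumes C: "closed C" and "\<not> convex C"
  obtains x u v where "x \<notin> C" "u \<in> C" "v \<in> C" "u \<noteq> v"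
    "dist x u = infdist x C" "dist x v = infdist x C"
proof -
  obtain p q m where pq: "p \<in> C" "q \<in> C" "m \<in> closed_segment p q" "m \<notin> C"
    using assms(2) unfolding convex_contains_segment by blast
  then have ne: "C \<noteq> {}" by auto
  \<comment> \<open>\<open>K > 0\<close> keeps the slope of the penalty below 1;
    \<open>K < infdist m C\<close> makes the objective positive at \<open>m\<close>, which forces
    the maximiser out of \<open>C\<close>.\<close>
  define K where "K = infdist m C / 2"
  have dm: "infdist m C > 0"
    using pq C ne infdist_pos_not_in_closed by blast
  then have K: "0 < K" "K < infdist m C" by (auto simp: K_def)
  define h where "h = (\<lambda>x. sqrt ((dist x m)\<^sup>2 + K\<^sup>2))"
  obtain x where max: "\<And>y. infdist y C - h y \<le> infdist x C - h x"
    using penalised_infdist_attains_max[OF pq(1-3) K] unfolding h_def by blast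
  define d where "d = infdist x C"
  define R where "R = dist x m"
  have hR: "h x > R"
    unfolding h_def R_def by (rule real_less_rsqrt) (use K in simp)
  have R0: "R \<ge> 0" by (simp add: R_def)
  have hx2: "(h x)\<^sup>2 = R\<^sup>2 + K\<^sup>2" by (simp add: h_def R_def)
  have "infdist m C - K \<le> d - h x"
    using max[of m] K by (simp add: h_def d_def)
  then have d: "d > 0" using K hR R0 by simp
  then have xC: "x \<notin> C" by (auto simp: d_def)
  obtain u where u: "u \<in> C" "dist x u = d"
    using infdist_attains_inf[OF C ne, of x] by (metis d_def)
  define e where "e = (x - u) /\<^sub>R d"
  have e: "norm e = 1" using u d by (simp add: e_def dist_norm)
  have ed: "e \<bullet> (x - u) = d"
    using u d by (simp add: e_def dist_norm power2_norm_eq_inner[symmetric] power2_eq_square)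
  \<comment> \<open>The midpoint of 1 and \<open>R / h x\<close>, the norm of the gradient of
    \<open>h\<close> at \<open>x\<close> (where \<open>h x > 0\<close>). The slack above that slope
    absorbs the quadratic term in \<open>t\<close>.\<close>
  define \<theta> where "\<theta> = (R + h x) / (2 * h x)"
  have th: "0 \<le> \<theta>" "\<theta> < 1" "2 * \<theta> * h x = R + h x"
    using hR R0 by (auto simp: \<theta>_def field_simps)
  \<comment> \<open>The half-space cuts off \<open>u\<close>, because
    \<open>e \<bullet> (x - u) = d > \<theta> * d\<close>.\<close>
  define S where "S = C \<inter> {z. e \<bullet> (x - z) \<le> \<theta> * d}"
  have clS: "closed S"
    unfolding S_def by (intro closed_Int C closed_Collect_le continuous_intros)
  have near: "\<exists>w\<in>S. dist x w \<le> d + 2 * t" if t: "0 < t" "t \<le> h x - R" for t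
  proof -
    define y where "y = x + t *\<^sub>R e"
    obtain w where w: "w \<in> C" "infdist y C = dist y w"
      using infdist_attains_inf[OF C ne] by metis
    have "dist y m \<le> R + t"
      using norm_triangle_ineq[of "x - m" "t *\<^sub>R e"] e t
      by (simp add: y_def R_def dist_norm algebra_simps)
    then have "(dist y m)\<^sup>2 + K\<^sup>2 \<le> (R + t)\<^sup>2 + K\<^sup>2"
      by (simp add: power_mono)
    also have "\<dots> = (h x)\<^sup>2 + t * (2 * R + t)"
      unfolding hx2 by (simp add: power2_eq_square algebra_simps)
    also have "\<dots> \<le> (h x)\<^sup>2 + t * (R + h x)"
      using t by simp
    also have "\<dots> = (h x)\<^sup>2 + 2 * (\<theta> * t) * h x"
      by (simp add: th(3)[symmetric])
    also have "\<dots> \<le> (h x + \<theta> * t)\<^sup>2"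
      by (simp add: power2_sum)
    finally have "sqrt ((dist y m)\<^sup>2 + K\<^sup>2) \<le> h x + \<theta> * t"
      using hR R0 th t by (intro real_le_lsqrt) auto
    then have "h y \<le> h x + \<theta> * t"
      by (simp add: h_def)
    then have le: "dist y w \<le> d + \<theta> * t"
      using max[of y] w by (simp add: d_def)
    \<comment> \<open>Expanding both squares and cancelling \<open>d\<close> against
      \<open>dist x w\<close> and \<open>\<theta> * t\<close> against \<open>t\<close> leaves the
      linear inequality defining \<open>S\<close>.\<close>
    then have "(dist y w)\<^sup>2 \<le> (d + \<theta> * t)\<^sup>2"
      by (intro power_mono) auto
    moreover have "(dist y w)\<^sup>2 = (dist x w)\<^sup>2 + 2 * t * (e \<bullet> (x - w)) + t\<^sup>2"
    proof -
      have eq: "y - w = (x - w) + t *\<^sub>R e" by (simp add: y_def)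
      have "e \<bullet> e = 1" using e by (simp add: norm_eq_1)
      then show ?thesis
        unfolding dist_norm eq power2_norm_eq_inner
        by (simp add: inner_add_left inner_add_right inner_commute power2_eq_square)
    qed
    moreover have "d\<^sup>2 \<le> (dist x w)\<^sup>2"
      using d w(1) infdist_le[of w C x] by (intro power_mono) (auto simp: d_def)
    moreover have "(\<theta> * t)\<^sup>2 \<le> t\<^sup>2"
      using th t by (intro power_mono) (auto simp: mult_left_le_one_le)
    ultimately have "2 * t * (e \<bullet> (x - w)) \<le> 2 * t * (\<theta> * d)"
      by (simp add: power2_sum mult_ac)
    then have "w \<in> S" using t w by (simp add: S_def)
    moreover have "dist x w \<le> d + 2 * t"
    proof -
      have "dist x y = t" using e t by (simp add: y_def dist_norm)
      moreover have "\<theta> * t \<le> t" using th t by (simp add: mult_left_le_one_le)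
      ultimately show ?thesis using dist_triangle[of x w y] le by linarith
    qed
    ultimately show ?thesis by blast
  qed
  have "S \<noteq> {}" using near[of "h x - R"] hR by auto
  \<comment> \<open>A point of the closed set \<open>S\<close> nearest to \<open>x\<close> takes the
    place of a limit of the points \<open>w\<close> as \<open>t\<close> tends to 0.\<close>
  then obtain v where v: "v \<in> S" "infdist x S = dist x v"
    using infdist_attains_inf[OF clS] by metis
  have "dist x v \<le> d"
  proof (rule field_le_epsilon)
    fix \<epsilon> :: real assume \<epsilon>: "0 < \<epsilon>"
    define t where "t = min (\<epsilon> / 2) (h x - R)"
    have t: "0 < t" "t \<le> h x - R" "2 * t \<le> \<epsilon>"
      using \<epsilon> hR by (auto simp: t_def min_def)
    obtain w where "w \<in> S" "dist x w \<le> d + 2 * t" using near[OF t(1,2)] by blast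
    then show "dist x v \<le> d + \<epsilon>"
      using infdist_le[of w S x] v t(3) by linarith
  qed
  moreover have vC: "v \<in> C" using v by (simp add: S_def)
  ultimately have "dist x v = d"
    using infdist_le[OF vC, of x] by (simp add: d_def)
  moreover have "\<theta> * d < d" using th d by simp
  then have "u \<noteq> v" using v ed by (auto simp: S_def)
  ultimately show thesis using that xC u vC d_def by metis
qed

text \<open>Both quotients have the same numerator, so it suffices to bound the infimum below by
  \<open>L\<close> and the square root strictly above by \<open>L\<close>.\<close>

lemma two_nearest_points_point_pair_gt:
  fixes G :: "'a::euclidean_space set"
  assumes G: "open G" and x: "x \<in> G" and uv: "u \<notin> G" "v \<notin> G" "u \<noteq> v"
    and du: "dist x u = infdist x (- G)" and dv: "dist x v = infdist x (- G)"
  obtains y z where "y \<in> G" "z \<in> G" "triangular_ratio G y z < point_pair G y z"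
proof -
  define d where "d = infdist x (- G)"
  define a where "a = u - x"
  define b where "b = v - x"
  have na: "norm a = d" and nb: "norm b = d"
    using du dv by (auto simp: a_def b_def d_def dist_norm norm_minus_commute)
  have ab: "a \<noteq> b" using uv by (simp add: a_def b_def)
  have d: "d > 0" using na nb ab by (metis norm_le_zero_iff not_le)
  have far: "d \<le> dist x w" if "w \<notin> G" for w
    using that infdist_le[of w "- G" x] by (simp add: d_def)
  then have ballG: "ball x d \<subseteq> G"
    by (metis mem_ball not_le subsetI)
  \<comment> \<open>Needed because \<open>boundary_dist\<close> and the infimum refer to the
    frontier, while \<open>u\<close> and \<open>v\<close> are only known to lie outside
    \<open>G\<close>.\<close>
  then have "cball x d \<subseteq> closure G"
    using d closure_mono closure_ball by metis
  then have fr: "u \<in> frontier G" "v \<in> frontier G"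
    using uv du dv G by (auto simp: frontier_def d_def interior_open)
  define c where "c = norm (a + b)"
  \<comment> \<open>The parallelogram law; with \<open>a \<noteq> b\<close> it makes
    \<open>c < 2 * d\<close> strict.\<close>
  have par: "c\<^sup>2 + (norm (a - b))\<^sup>2 = 4 * d\<^sup>2"
  proof -
    have "a \<bullet> a = d\<^sup>2" "b \<bullet> b = d\<^sup>2"
      using na nb by (simp_all flip: power2_norm_eq_inner)
    then show ?thesis
      unfolding c_def power2_norm_eq_inner
      by (simp add: inner_diff_left inner_diff_right inner_add_left inner_add_right inner_commute)
  qed
  have abp: "(norm (a - b))\<^sup>2 > 0" using ab by simp
  have "c\<^sup>2 < 4 * d\<^sup>2" using par abp by linarith
  then have "c\<^sup>2 < (2 * d)\<^sup>2" by (simp add: power_mult_distrib)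
  then have c: "c < 2 * d" by (rule power_less_imp_less_base) (use d in simp)
  define y where "y = x + (1/4) *\<^sub>R a"
  define z where "z = x + (1/4) *\<^sub>R b"
  have yz: "y \<in> G" "z \<in> G"
    using ballG na nb d by (auto simp: y_def z_def dist_norm subset_iff)
  define L where "L = 2 * d - c / 4"
  have L: "L > 0" using c d by (simp add: L_def)
  define I where "I = (INF w\<in>frontier G. norm (y - w) + norm (w - z))"
  have I: "L \<le> I"
    unfolding I_def
  proof (rule cINF_greatest)
    fix w assume "w \<in> frontier G"
    then have "w \<notin> G" using G by (simp add: frontier_def interior_open)
    then have "d \<le> norm (w - x)" using far by (metis dist_norm norm_minus_commute)
    then have "2 * d \<le> norm (2 *\<^sub>R (w - x))" by simp
    \<comment> \<open>Since \<open>y\<close> and \<open>z\<close> average to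
      \<open>x + (a + b) / 8\<close>, the triangle inequality loses only
      \<open>c / 4\<close>.\<close>
    also have "2 *\<^sub>R (w - x) = (1/4) *\<^sub>R (a + b) + ((w - y) + (w - z))"
      by (simp add: y_def z_def algebra_simps flip: scaleR_2)
    also have "norm \<dots> \<le> c / 4 + (norm (w - y) + norm (w - z))"
      using norm_triangle_ineq[of "(1/4) *\<^sub>R (a + b)" "(w - y) + (w - z)"]
        norm_triangle_ineq[of "w - y" "w - z"] by (simp add: c_def)
    finally show "L \<le> norm (y - w) + norm (w - z)"
      by (simp add: L_def norm_minus_commute)
  qed (use fr in auto)
  define N where "N = norm (y - z)"
  have "y - z = (1/4) *\<^sub>R (a - b)" by (simp add: y_def z_def algebra_simps)
  then have N: "N = norm (a - b) / 4" by (simp add: N_def)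
  then have N0: "N > 0" unfolding N using ab by simp
  have "y - u = (-3/4) *\<^sub>R a" "z - v = (-3/4) *\<^sub>R b"
    by (simp_all add: y_def z_def a_def b_def algebra_simps flip: scaleR_add_left)
  then have "dist y u = 3/4 * d" "dist z v = 3/4 * d"
    using na nb by (simp_all add: dist_norm)
  then have bd: "boundary_dist G y \<le> 3/4 * d" "boundary_dist G z \<le> 3/4 * d"
    using infdist_le[OF fr(1), of y] infdist_le[OF fr(2), of z] by (auto simp: boundary_dist_def)
  define Q where "Q = N\<^sup>2 + 4 * boundary_dist G y * boundary_dist G z"
  have bd0: "0 \<le> boundary_dist G w" for w by (simp add: boundary_dist_def infdist_nonneg)
  have Q0: "Q > 0" using N0 bd0 by (simp add: Q_def add_pos_nonneg)
  have "boundary_dist G y * boundary_dist G z \<le> (3/4 * d) * (3/4 * d)"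
    using bd bd0 d by (intro mult_mono) auto
  then have "Q \<le> (4 * d\<^sup>2 - c\<^sup>2) / 16 + 9/4 * d\<^sup>2"
    using par by (simp add: Q_def N power_divide power2_eq_square mult.assoc field_simps)
  \<comment> \<open>The subtracted product is positive because \<open>c < 2 * d\<close>.\<close>
  also have "\<dots> = L\<^sup>2 - (2 * d - c) * (6 * d - c) / 8"
    by (simp add: L_def power2_eq_square field_simps)
  also have "\<dots> < L\<^sup>2" using c d by simp
  finally have "sqrt Q < L" using L by (simp add: real_less_lsqrt)
  then have "N / I < N / sqrt Q"
    using I Q0 N0 L by (intro divide_strict_left_mono mult_pos_pos) auto
  then have "triangular_ratio G y z < point_pair G y z"
    by (simp add: triangular_ratio_def point_pair_def I_def N_def Q_def)
  then show thesis using that yz by blast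
qed

theorem theorem3p6:
  fixes G :: "(real ^ 'n) set"
  assumes "is_domain G"
    and "G \<noteq> UNIV"
    and "\<And>x y. x \<in> G \<Longrightarrow> y \<in> G \<Longrightarrow> triangular_ratio G x y \<ge> point_pair G x y"
  shows "connected (UNIV - G) \<and> convex (UNIV - G)"
proof -
  have G: "open G" using assms(1) by (simp add: is_domain_def)
  have "convex (- G)"
  proof (rule ccontr)
    assume nc: "\<not> convex (- G)"
    have "closed (- G)" using G by (simp add: closed_Compl)
    from this nc obtain x u v where "x \<in> G" "u \<notin> G" "v \<notin> G" "u \<noteq> v"
      "dist x u = infdist x (- G)" "dist x v = infdist x (- G)"
      by (rule closed_not_convex_two_nearest_points) auto
    with G obtain y z where "y \<in> G" "z \<in> G" "triangular_ratio G y z < point_pair G y z"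
      by (metis two_nearest_points_point_pair_gt)
    then show False using assms(3) by (meson not_le)
  qed
  then show ?thesis by (simp add: convex_connected flip: Compl_eq_Diff_UNIV)
qed

end
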